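(* (Sine recovery lemma) Let $f$ be an entire function of genus one (in the sense of the context) such that $f(0)\neq 0$, with zeros $\{\lambda_i\}$ listed with multiplicity. If $$\sum_i \sin\left(\frac{t}{\lambda_i-x}\right)^2 \geq 0$$ (that is, the sum is real and nonnegative) for all $t \in \mathbb{R}$ and all $x\in \mathbb{R} \setminus \{\lambda_i\}$, then the aperture of $f$ is $\kappa = \infty$.
   Context: An entire function of genus one with $f(0)\ne 0$ means a function of the form $$f(z) = e^{d_1+d_2z}\prod_{i=1}^{\infty} \left( 1 - \frac{z}{\lambda_i} \right) e^{z/\lambda_i},$$ where $d_1,d_2\in\mathbb{C}$, the $\lambda_i$ are nonzero complex numbers (the zeros of $f$ listed with multiplicity), and $\sum_i \frac{1}{|\lambda_i|^2} <\infty$. Here $\sin(w)^2$ means $(\sin w)^2$. The spacing constant $c$ of $f$ is $c=0$ if $f$ has a repeated zero, and, if all zeros are simple, $$c=\inf_{i \ne j} \left\{ \left| \Re(\lambda_i-\lambda_j) \right|: \lambda_i \ne \bar{\lambda}_j \right\}.$$ The height of $f$ is $b= \inf_i \{| \Im (\lambda_i)| : \Im (\lambda_i) \neq 0\}$, with $b=\infty$ if there are no non-real zeros. The aperture of $f$ is $\kappa = b/c$ if $c\neq 0$, and $\kappa=\infty$ if $c=0$ (also $\kappa=\infty$ if $b=\infty$). *)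

theory Defs
  imports "HOL-Complex_Analysis.Complex_Analysis"
begin

text \<open>
  The sequence \<open>lam\<close> lists the zeros of \<open>f\<close> with multiplicity. The summability condition makes the
  product converge absolutely and locally uniformly, so the order of the factors is irrelevant.
\<close>

definition genus_one_with_zeros :: "(complex \<Rightarrow> complex) \<Rightarrow> (nat \<Rightarrow> complex) \<Rightarrow> bool" where
  "genus_one_with_zeros f lam \<longleftrightarrow>
     (\<forall>i. lam i \<noteq> 0) \<and>
     summable (\<lambda>i. 1 / (cmod (lam i))\<^sup>2) \<and>
     (\<exists>d1 d2. \<forall>z. f z = exp (d1 + d2 * z) * (\<Prod>i. (1 - z / lam i) * exp (z / lam i)))"

text \<open>
  The spacing constant, the height and the aperture are attached to \<open>f\<close> itself, so they do not
  depend on how the zeros are enumerated. In the second branch of \<open>spacing\<close> all zeros are simple,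
  so pairs of different indices are the same as pairs of different zeros.
  All three take values in \<^typ>\<open>ereal\<close>, where the infimum of the empty set is \<open>\<infinity>\<close>.
\<close>

definition spacing :: "(complex \<Rightarrow> complex) \<Rightarrow> ereal" where
  "spacing f =
     (if \<exists>z. f z = 0 \<and> zorder f z \<ge> 2 then 0
      else Inf {ereal \<bar>Re (z - w)\<bar> | z w. f z = 0 \<and> f w = 0 \<and> z \<noteq> w \<and> z \<noteq> cnj w})"

definition height :: "(complex \<Rightarrow> complex) \<Rightarrow> ereal" where
  "height f = Inf {ereal \<bar>Im z\<bar> | z. f z = 0 \<and> Im z \<noteq> 0}"

definition aperture :: "(complex \<Rightarrow> complex) \<Rightarrow> ereal" where
  "aperture f = (if spacing f = 0 \<or> height f = \<infinity> then \<infinity> else height f / spacing f)"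

end

theory Submission
  imports Defs "HOL-Real_Asymp.Real_Asymp"
begin

text \<open>
  Taking \<open>x = 0\<close> suffices, and the hypothesis even forces every zero to be real. Put
  \<open>v\<^sub>i = 1 / \<lambda>\<^sub>i\<close> and \<open>G = max\<^sub>i \<bar>Im v\<^sub>i\<bar>\<close>; the maximum exists since \<open>v\<^sub>i \<rightarrow> 0\<close>. As
  \<open>Re (sin (t v\<^sub>i))\<^sup>2 = (1 - cos (2 t Re v\<^sub>i) cosh (2 t Im v\<^sub>i)) / 2\<close>, the finitely many indices
  attaining \<open>G\<close> contribute terms of size \<open>exp (2 G t)\<close>, and by Dirichlet's theorem there are
  arbitrarily large \<open>t\<close> at which all the cosines in these terms are at least \<open>1/2\<close>, so that the
  terms are negative. The remaining indices contribute at most \<open>C t\<^sup>2 exp (2 g t)\<close> with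
  \<open>g < G\<close>. If \<open>G > 0\<close>, the sum therefore has negative real part for some large \<open>t\<close>.
\<close>

text \<open>Mean value inequality on the segment from 0 to \<open>w\<close>, where the derivative
  \<open>cos\<close> is at most \<open>exp \<bar>Im w\<bar>\<close> in modulus. The factor
  \<open>cmod w\<close> is what makes the squares summable over the zeros.\<close>

lemma cmod_sin_le: "cmod (sin w) \<le> cmod w * exp \<bar>Im w\<bar>"
proof -
  have "cmod (sin w - sin 0) \<le> exp \<bar>Im w\<bar> * cmod (w - 0)"
  proof (rule field_differentiable_bound[of "closed_segment 0 w" sin cos])
    fix z assume "z \<in> closed_segment 0 w"
    then obtain u where "0 \<le> u" "u \<le> 1" "z = u *\<^sub>R w"
      by (auto simp: closed_segment_def)
    then show "cmod (cos z) \<le> exp \<bar>Im w\<bar>"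
      using cmod_cos_le_exp by blast
  qed (auto intro: DERIV_sin has_field_derivative_at_within)
  then show ?thesis by (simp add: mult.commute)
qed

lemma cmod_sin_squared_le: "cmod ((sin w)\<^sup>2) \<le> (cmod w)\<^sup>2 * exp (2 * \<bar>Im w\<bar>)"
  using power_mono[OF cmod_sin_le, of w 2] by (simp add: norm_power power_mult_distrib exp_double)

lemma Re_sin_squared:
  "Re ((sin w)\<^sup>2) = (1 - cos (2 * Re w) * cosh (2 * Im w)) / 2"
proof -
  have "(sin w)\<^sup>2 = (1 - cos (2 * w)) / 2"
    by (simp add: cos_double_sin)
  then have "Re ((sin w)\<^sup>2) = Re ((1 - cos (2 * w)) / 2)" by (rule arg_cong)
  then show ?thesis by (simp add: Re_cos cosh_field_def)
qed

text \<open>Dirichlet approximation of the numbers \<open>T * a i / (2 * pi)\<close> with a common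
  denominator \<open>q \<ge> 1\<close> puts every \<open>q * T * a i\<close> close to a multiple of
  \<open>2 * pi\<close>. Scaling by \<open>T\<close> first makes \<open>t = q * T\<close> at least
  \<open>T\<close>.\<close>

lemma cos_simultaneously_ge_half:
  fixes a :: "nat \<Rightarrow> real"
  assumes "finite A" "T > 0"
  obtains t where "t \<ge> T" "\<And>i. i \<in> A \<Longrightarrow> cos (t * a i) \<ge> 1 / 2"
proof -
  obtain n where n: "\<And>i. i \<in> A \<Longrightarrow> i < n"
    using assms(1) finite_nat_iff_bounded by auto
  obtain q p where q: "0 < q"
    and qp: "\<And>i. i < n \<Longrightarrow> \<bar>of_int q * (T * a i / (2 * pi)) - of_int (p i)\<bar> < 1 / real 6"
    \<comment> \<open>An error below \<open>1/6\<close> of a period is an angle below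
      \<open>pi / 3\<close>, whose cosine is at least \<open>1/2\<close>.\<close>
    by (rule Dirichlet_approx_simult[of 6 n "\<lambda>i. T * a i / (2 * pi)"]) auto
  show thesis
  proof (rule that[of "of_int q * T"])
    show "of_int q * T \<ge> T" using q assms(2) by simp
  next
    fix i assume "i \<in> A"
    define d where "d = of_int q * T * a i - 2 * pi * of_int (p i)"
    have "d = 2 * pi * (of_int q * (T * a i / (2 * pi)) - of_int (p i))"
      by (simp add: d_def field_simps)
    then have "\<bar>d\<bar> = 2 * pi * \<bar>of_int q * (T * a i / (2 * pi)) - of_int (p i)\<bar>"
      by (simp add: abs_mult)
    also have "\<dots> \<le> 2 * pi * (1 / 6)"
      using qp[OF n[OF \<open>i \<in> A\<close>]] by (intro mult_left_mono) auto
    finally have d: "\<bar>d\<bar> \<le> pi / 3" by simp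
    have "cos (pi / 3) \<le> cos \<bar>d\<bar>"
      using d by (intro cos_monotone_0_pi_le) auto
    moreover have "cos (of_int q * T * a i) = cos d"
      by (simp add: d_def cos_diff)
    ultimately show "cos (of_int q * T * a i) \<ge> 1 / 2"
      by (simp add: cos_60)
  qed
qed

text \<open>For fixed \<open>t\<close> the exponential factor in the bound for the squared sine is
  bounded uniformly in \<open>i\<close>, since \<open>v\<close> is bounded; this leaves a constant
  multiple of \<open>(cmod (v i))\<^sup>2\<close>.\<close>

lemma summable_sin_squared:
  fixes v :: "nat \<Rightarrow> complex"
  assumes v: "summable (\<lambda>i. (cmod (v i))\<^sup>2)"
  shows "summable (\<lambda>i. (sin (of_real t * v i))\<^sup>2)"
proof -
  have "(\<lambda>i. cmod (v i) ^ 2) \<longlonglongrightarrow> 0"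
    using v by (rule summable_LIMSEQ_zero)
  then have "(\<lambda>i. cmod (v i)) \<longlonglongrightarrow> 0"
    by simp
  then have "Bseq (\<lambda>i. cmod (v i))"
    by (intro convergent_imp_Bseq convergentI)
  then obtain B where B: "\<And>i. cmod (v i) \<le> B"
    by (auto simp: Bseq_def)
  show ?thesis
  proof (rule summable_comparison_test'[where N = 0])
    show "summable (\<lambda>i. (cmod (v i))\<^sup>2 * (t\<^sup>2 * exp (2 * (\<bar>t\<bar> * B))))"
      by (rule summable_mult2[OF v])
  next
    fix i
    have "\<bar>Im (v i)\<bar> \<le> B"
      using abs_Im_le_cmod[of "v i"] B[of i] by linarith
    then have "\<bar>t * Im (v i)\<bar> \<le> \<bar>t\<bar> * B"
      by (simp add: abs_mult mult_left_mono)
    then have "(cmod (t * v i))\<^sup>2 * exp (2 * \<bar>Im (t * v i)\<bar>) \<le> (cmod (t * v i))\<^sup>2 * exp (2 * (\<bar>t\<bar> * B))"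
      by (intro mult_left_mono) auto
    then show "norm ((sin (of_real t * v i))\<^sup>2) \<le> (cmod (v i))\<^sup>2 * (t\<^sup>2 * exp (2 * (\<bar>t\<bar> * B)))"
      using cmod_sin_squared_le[of "t * v i"]
      by (simp add: norm_mult power_mult_distrib mult_ac)
  qed
qed

text \<open>After division by \<open>exp (2 * t * G)\<close> the left side tends to 0, because
  \<open>G > 0\<close> and \<open>g < G\<close>.\<close>

lemma exp_dominates_eventually:
  fixes C g G :: real
  assumes "g < G" "0 < G"
  shows "eventually (\<lambda>t. 1 / 2 + C * (t\<^sup>2 * exp (2 * t * g)) < exp (2 * t * G) / 8) at_top"
proof -
  define e where "e = 2 * (G - g)"
  have e: "e > 0" using assms by (simp add: e_def)
  have 1: "((\<lambda>t. t\<^sup>2 * exp (- (e * t))) \<longlongrightarrow> 0) at_top" using e by real_asymp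
  have 2: "((\<lambda>t. exp (- (2 * G * t))) \<longlongrightarrow> 0) at_top" using assms(2) by real_asymp
  have "((\<lambda>t. exp (- (2 * G * t)) / 2 + C * (t\<^sup>2 * exp (- (e * t)))) \<longlongrightarrow> 0 / 2 + C * 0) at_top"
    by (intro tendsto_intros 1 2) auto
  then have "eventually (\<lambda>t. exp (- (2 * G * t)) / 2 + C * (t\<^sup>2 * exp (- (e * t))) < 1 / 8) at_top"
    by (rule order_tendstoD) simp
  then show ?thesis
  proof eventually_elim
    case (elim t)
    have "exp (2 * t * G) * (exp (- (2 * G * t)) / 2 + C * (t\<^sup>2 * exp (- (e * t))))
        < exp (2 * t * G) * (1 / 8)"
      using elim by (intro mult_strict_left_mono) auto
    moreover have "exp (2 * t * G) * exp (- (2 * G * t)) = 1"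
      by (simp flip: exp_add)
    moreover have "exp (2 * t * G) * exp (- (e * t)) = exp (2 * t * g)"
      by (simp add: e_def algebra_simps flip: exp_add)
    ultimately show ?case by (simp add: algebra_simps)
  qed
qed

lemma sum_sin_squared_negative:
  fixes v :: "nat \<Rightarrow> complex"
  assumes v: "summable (\<lambda>i. (cmod (v i))\<^sup>2)" and k: "Im (v k) \<noteq> 0"
  obtains t where "Re (\<Sum>i. (sin (of_real t * v i))\<^sup>2) < 0"
proof -
  define m where "m = (\<lambda>i. \<bar>Im (v i)\<bar>)"
  \<comment> \<open>Outside \<open>S\<close>, \<open>m i\<close> is below half of
    \<open>m k\<close>, so the maximum of \<open>m\<close> is attained on \<open>S\<close>, which is
    finite because \<open>v i\<close> tends to 0.\<close>
  define S where "S = {i. cmod (v i) \<ge> m k / 2}"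
  have mk: "m k > 0" using k by (simp add: m_def)
  have m_le: "m i \<le> cmod (v i)" for i by (simp add: m_def abs_Im_le_cmod)
  have "(\<lambda>i. cmod (v i) ^ 2) \<longlonglongrightarrow> 0"
    using v by (rule summable_LIMSEQ_zero)
  then have "(\<lambda>i. cmod (v i)) \<longlonglongrightarrow> 0"
    by simp
  then have "eventually (\<lambda>i. cmod (v i) < m k / 2) sequentially"
    by (rule order_tendstoD) (use mk in auto)
  then have S: "finite S"
    by (simp add: S_def not_less eventually_cofinite flip: cofinite_eq_sequentially)
  have kS: "k \<in> S" using m_le[of k] mk by (simp add: S_def)
  define G where "G = Max (m ` S)"
  have mG: "m i \<le> G" if "i \<in> S" for i
    using that S by (simp add: G_def)
  have G: "m k \<le> G" "G > 0" using mG[OF kS] mk by auto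
  define D where "D = {i \<in> S. m i = G}"
  \<comment> \<open>The entry \<open>G / 2\<close> bounds \<open>m\<close> outside \<open>S\<close>
    and keeps the set nonempty when \<open>S = D\<close>.\<close>
  define g where "g = Max (insert (G / 2) (m ` (S - D)))"
  have D: "finite D" using S by (simp add: D_def)
  have "G \<in> m ` S" unfolding G_def using S kS by (intro Max_in) auto
  then have "D \<noteq> {}" by (auto simp: D_def)
  then obtain j where j: "j \<in> D" by blast
  have gG: "g < G"
    unfolding g_def using S G mG by (subst Max_less_iff) (auto simp: D_def less_le)
  have mg: "m i \<le> g" if "i \<notin> D" for i
  proof (cases "i \<in> S")
    case True
    then show ?thesis using that S by (simp add: g_def)
  next
    case False
    then have "m i \<le> G / 2" using m_le[of i] G by (simp add: S_def)
    also have "\<dots> \<le> g" unfolding g_def using S by (intro Max_ge) auto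
    finally show ?thesis .
  qed
  define C where "C = (\<Sum>i. (cmod (v i))\<^sup>2)"
  obtain T where T: "\<And>t. t \<ge> T \<Longrightarrow> 1 / 2 + C * (t\<^sup>2 * exp (2 * t * g)) < exp (2 * t * G) / 8"
    using exp_dominates_eventually[OF gG G(2)] by (auto simp: eventually_at_top_linorder)
  have C: "C \<ge> 0" using v by (simp add: C_def suminf_nonneg)
  \<comment> \<open>\<open>T\<close> secures the growth comparison, 1 the positivity of
    \<open>t\<close>.\<close>
  obtain t where t: "t \<ge> max T 1" and cos: "\<And>i. i \<in> D \<Longrightarrow> cos (t * (2 * Re (v i))) \<ge> 1 / 2"
    by (rule cos_simultaneously_ge_half[OF D, of "max T 1" "\<lambda>i. 2 * Re (v i)"]) auto
  have t0: "t > 0" using t by auto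
  define F where "F = (\<lambda>i. Re ((sin (of_real t * v i))\<^sup>2))"
  \<comment> \<open>With cosine at least \<open>1/2\<close> and \<open>cosh\<close> at least
    \<open>exp (2 * t * G) / 2\<close>, the formula for the real part gives at most
    \<open>(1 - exp (2 * t * G) / 4) / 2\<close>, which is \<open>- K\<close>.\<close>
  define K where "K = exp (2 * t * G) / 8 - 1 / 2"
  have K: "K > 0"
  proof -
    have "0 \<le> C * (t\<^sup>2 * exp (2 * t * g))" using C by simp
    then show ?thesis using T[of t] t unfolding K_def by linarith
  qed
  have FD: "F i \<le> - K" if "i \<in> D" for i
  proof -
    have "\<bar>2 * (t * Im (v i))\<bar> = 2 * t * G"
      using that t0 by (auto simp: D_def m_def abs_mult)
    then have "cosh (2 * (t * Im (v i))) = cosh (2 * t * G)"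
      by (metis cosh_real_abs)
    moreover have "exp (2 * t * G) / 2 \<le> cosh (2 * t * G)"
      by (simp add: cosh_field_def)
    ultimately have cosh: "exp (2 * t * G) / 2 \<le> cosh (2 * (t * Im (v i)))"
      by (simp only:)
    have half: "1 / 2 \<le> cos (2 * (t * Re (v i)))"
      using cos[OF that] by (simp only: mult.left_commute)
    have "1 / 2 * (exp (2 * t * G) / 2) \<le> cos (2 * (t * Re (v i))) * cosh (2 * (t * Im (v i)))"
      using half by (intro mult_mono cosh) auto
    then show ?thesis by (simp add: F_def Re_sin_squared K_def)
  qed
  have Fg: "F i \<le> (cmod (v i))\<^sup>2 * (t\<^sup>2 * exp (2 * t * g))" if "i \<notin> D" for i
  proof -
    have "F i \<le> cmod ((sin (of_real t * v i))\<^sup>2)"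
      unfolding F_def by (rule complex_Re_le_cmod)
    also have "\<dots> \<le> (cmod (t * v i))\<^sup>2 * exp (2 * \<bar>Im (t * v i)\<bar>)"
      by (rule cmod_sin_squared_le)
    also have "\<dots> \<le> (cmod (t * v i))\<^sup>2 * exp (2 * t * g)"
      using mg[OF that] t0 by (intro mult_left_mono) (auto simp: m_def abs_mult)
    finally show ?thesis by (simp add: norm_mult power_mult_distrib mult_ac)
  qed
  \<comment> \<open>A single dominant index \<open>j\<close> supplies \<open>- K\<close>. The other
    terms from \<open>D\<close> are negative, so the nonnegative majorant of the remaining terms
    covers them too and sums to a multiple of the full \<open>C\<close>.\<close>
  define H where "H = (\<lambda>i. (if i = j then - K else 0) + (cmod (v i))\<^sup>2 * (t\<^sup>2 * exp (2 * t * g)))"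
  have "F i \<le> H i" for i
  proof (cases "i \<in> D")
    case True
    have "0 \<le> (cmod (v i))\<^sup>2 * (t\<^sup>2 * exp (2 * t * g))" by simp
    moreover have "- K \<le> (if i = j then - K else 0)" using K by simp
    ultimately show ?thesis using FD[OF True] unfolding H_def by linarith
  next
    case False
    then show ?thesis using Fg[OF False] j by (auto simp: H_def)
  qed
  moreover have "H sums (- K + C * (t\<^sup>2 * exp (2 * t * g)))"
    unfolding H_def C_def
    by (intro sums_add sums_mult2 summable_sums[OF v] sums_single)
  moreover have "F sums Re (\<Sum>i. (sin (of_real t * v i))\<^sup>2)"
    unfolding F_def by (intro sums_Re summable_sums summable_sin_squared[OF v])
  ultimately have "Re (\<Sum>i. (sin (of_real t * v i))\<^sup>2) \<le> - K + C * (t\<^sup>2 * exp (2 * t * g))"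
    using sums_le by blast
  also have "\<dots> < 0" using T[of t] t by (simp add: K_def)
  finally show thesis by (rule that)
qed

text \<open>The factors are Weierstrass factors \<open>E(u)\<close> of genus one with
  \<open>E(u) - 1 = O(u^2)\<close> near 0, so the product converges absolutely, and a convergent
  product without zero factors is nonzero. This carries reality of the \<open>lam i\<close> over to
  the zeros of \<open>f\<close>.\<close>

lemma genus_one_zero_in_range:
  assumes f: "genus_one_with_zeros f lam" and z: "f z = 0"
  shows "z \<in> range lam"
proof (rule ccontr)
  assume nz: "z \<notin> range lam"
  have lam: "\<And>i. lam i \<noteq> 0"
    and sum: "summable (\<lambda>i. 1 / (cmod (lam i))\<^sup>2)"
    using f by (auto simp: genus_one_with_zeros_def)
  obtain d1 d2 where "f z = exp (d1 + d2 * z) * (\<Prod>i. (1 - z / lam i) * exp (z / lam i))"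
    using f by (auto simp: genus_one_with_zeros_def)
  then have "(\<Prod>i. weierstrass_factor 1 (z / lam i)) = 0"
    using z by (simp add: weierstrass_factor_def)
  moreover have "(\<Prod>i. weierstrass_factor 1 (z / lam i)) \<noteq> 0"
  proof (rule prodinf_nonzero)
    show "weierstrass_factor 1 (z / lam i) \<noteq> 0" for i
      using nz lam[of i] by (auto simp: field_simps)
    have sum': "summable (\<lambda>i. (cmod (z / lam i))\<^sup>2)"
      using summable_mult[OF sum, of "(cmod z)\<^sup>2"] by (simp add: norm_divide power_divide)
    then have "(\<lambda>i. (cmod (z / lam i))\<^sup>2) \<longlonglongrightarrow> 0"
      by (rule summable_LIMSEQ_zero)
    then have "(\<lambda>i. cmod (z / lam i)) \<longlonglongrightarrow> 0"
      by simp
    \<comment> \<open>The quadratic estimate for the Weierstrass factor is applied in the disc of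
      radius \<open>1/2\<close>.\<close>
    then have "eventually (\<lambda>i. cmod (z / lam i) < 1 / 2) sequentially"
      by (rule order_tendstoD) auto
    then have "eventually (\<lambda>i. norm (norm (weierstrass_factor 1 (z / lam i) - 1))
                             \<le> 3 * (cmod (z / lam i))\<^sup>2) sequentially"
    proof eventually_elim
      case (elim i)
      then show ?case using weierstrass_factor_bound[of "z / lam i" 1]
        by (simp add: numeral_2_eq_2)
    qed
    then have "summable (\<lambda>i. norm (weierstrass_factor 1 (z / lam i) - 1))"
      by (rule summable_comparison_test_ev) (intro summable_mult sum')
    then show "convergent_prod (\<lambda>i. weierstrass_factor 1 (z / lam i))"
      by (intro abs_convergent_prod_imp_convergent_prod summable_imp_abs_convergent_prod)
  qed
  ultimately show False by contradiction
qed

theorem lemma1p3: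
  fixes f :: "complex \<Rightarrow> complex" and lam :: "nat \<Rightarrow> complex"
  assumes "genus_one_with_zeros f lam"
    and "f 0 \<noteq> 0"
    and "\<And>t x :: real. complex_of_real x \<notin> range lam \<Longrightarrow>
           (\<Sum>i. (sin (complex_of_real t / (lam i - complex_of_real x)))\<^sup>2) \<in> \<real>\<^sub>\<ge>\<^sub>0"
  shows "aperture f = \<infinity>"
proof -
  have lam: "\<And>i. lam i \<noteq> 0"
    and sum: "summable (\<lambda>i. 1 / (cmod (lam i))\<^sup>2)"
    using assms(1) by (auto simp: genus_one_with_zeros_def)
  have nonneg: "Re (\<Sum>i. (sin (of_real t * (1 / lam i)))\<^sup>2) \<ge> 0" for t
  proof -
    have "complex_of_real 0 \<notin> range lam" using lam by force
    from assms(3)[OF this, of t] show ?thesis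
      by (simp add: complex_nonneg_Reals_iff)
  qed
  have real: "Im (lam k) = 0" for k
  proof (rule ccontr)
    assume "Im (lam k) \<noteq> 0"
    then have "Im (1 / lam k) \<noteq> 0"
      using lam[of k] by (simp add: Im_divide complex_eq_iff sum_power2_eq_zero_iff)
    moreover have "summable (\<lambda>i. (cmod (1 / lam i))\<^sup>2)"
      using sum by (simp add: norm_divide power_divide)
    ultimately obtain t where "Re (\<Sum>i. (sin (of_real t * (1 / lam i)))\<^sup>2) < 0"
      using sum_sin_squared_negative[of "\<lambda>i. 1 / lam i" k] by blast
    with nonneg[of t] show False by simp
  qed
  have "Im z = 0" if "f z = 0" for z
    using genus_one_zero_in_range[OF assms(1) that] real by auto
  \<comment> \<open>The height is now an infimum over the empty set, hence infinite, which selects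
    the infinite branch of \<open>aperture\<close> whatever the spacing.\<close>
  then have "{ereal \<bar>Im z\<bar> | z. f z = 0 \<and> Im z \<noteq> 0} = {}"
    by auto
  then have "height f = \<infinity>"
    by (simp only: height_def Inf_empty top_ereal_def)
  then show ?thesis by (simp add: aperture_def)
qed

end
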